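(* Let $\mathcal T$ be a triangulated category (in the sense of Puppe). For each morphism $f:A\to B$ of $\mathcal T$ choose a distinguished triangle $A\xrightarrow{f}B\xrightarrow{u_f}C_f\xrightarrow{v_f}A[1]$, and let $\mathsf{Triangles}_0(\mathcal T)$ be the category of the chosen triangles. Let $\pi:\mathsf{Triangles}_0(\mathcal T)\to\mathcal T^{[1]}$ be the functor to the category of arrows of $\mathcal T$ which is the identity on objects and sends $(a,b,c)$ to $(a,b)$. Then the kernel of $\pi$, i.e. the ideal of all morphisms $(a,b,c)$ with $\pi(a,b,c)=0$, is a square zero ideal: the composite of any two composable morphisms of $\ker\pi$ is zero.
   Context: A (Puppe) triangulated category is an additive category $\mathcal T$ with an autoequivalence $A\mapsto A[1]$ and a class of diagrams $X\to Y\to Z\to X[1]$ (distinguished triangles) such that: (TR1) the class is closed under isomorphism of such diagrams (isomorphisms $(a,b,c,a[1])$); (TR2) $X\xrightarrow{\mathrm{id}}X\to0\to X[1]$ is distinguished; (TR3) if $X\xrightarrow{f}Y\xrightarrow{g}Z\xrightarrow{h}X[1]$ is distinguished then so is $Y\xrightarrow{g}Z\xrightarrow{h}X[1]\xrightarrow{-f[1]}Y[1]$; (TR4) every $f:X\to Y$ is the first map of some distinguished triangle; (TR5) any commutative square between the first maps of two distinguished triangles extends to a morphism of triangles. The octahedral axiom is not assumed. The category of arrows $\mathcal T^{[1]}$ has as objects the morphisms $f:A\to B$ of $\mathcal T$; a morphism from $f:A\to B$ to $f':A'\to B'$ is a pair $(a:A\to A',b:B\to B')$ with $bf=f'a$.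 The category $\mathsf{Triangles}_0(\mathcal T)$ has the same objects (written $[f]$); a morphism $[f]\to[f']$ is a triple $(a:A\to A',b:B\to B',c:C_f\to C_{f'})$ with $bf=f'a$, $cu_f=u_{f'}b$, $a[1]v_f=v_{f'}c$. *)

theory Defs
  imports "HOL-Algebra.Group"
begin

section \<open>Categories and functors\<close>

record ('o, 'm) cat =
  Obj :: "'o set"
  Arr :: "'m set"
  Dom :: "'m \<Rightarrow> 'o"
  Cod :: "'m \<Rightarrow> 'o"
  Idt :: "'o \<Rightarrow> 'm"
  Comp :: "'m \<Rightarrow> 'm \<Rightarrow> 'm"  (infixr \<open>\<cdot>\<index>\<close> 70)

definition Hom :: "('o, 'm, 'z) cat_scheme \<Rightarrow> 'o \<Rightarrow> 'o \<Rightarrow> 'm set" where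
  "Hom C X Y = {f \<in> Arr C. Dom C f = X \<and> Cod C f = Y}"

text \<open>Composition is total on the type of arrows; only composable pairs are meaningful.
  \<open>g \<cdot> f\<close> is first \<open>f\<close>, then \<open>g\<close>.\<close>

locale category =
  fixes C :: "('o, 'm, 'z) cat_scheme" (structure)
  assumes Dom_Obj: "f \<in> Arr C \<Longrightarrow> Dom C f \<in> Obj C"
    and Cod_Obj: "f \<in> Arr C \<Longrightarrow> Cod C f \<in> Obj C"
    and Idt_Hom: "X \<in> Obj C \<Longrightarrow> Idt C X \<in> Hom C X X"
    and Comp_Hom: "f \<in> Hom C X Y \<Longrightarrow> g \<in> Hom C Y Z \<Longrightarrow> g \<cdot> f \<in> Hom C X Z"
    and Comp_Idt_left: "f \<in> Hom C X Y \<Longrightarrow> Idt C Y \<cdot> f = f"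
    and Comp_Idt_right: "f \<in> Hom C X Y \<Longrightarrow> f \<cdot> Idt C X = f"
    and Comp_assoc: "f \<in> Hom C W X \<Longrightarrow> g \<in> Hom C X Y \<Longrightarrow> h \<in> Hom C Y Z \<Longrightarrow>
      (h \<cdot> g) \<cdot> f = h \<cdot> (g \<cdot> f)"

definition iso_arr :: "('o, 'm, 'z) cat_scheme \<Rightarrow> 'm \<Rightarrow> bool" where
  "iso_arr C f \<longleftrightarrow> f \<in> Arr C \<and>
    (\<exists>g \<in> Hom C (Cod C f) (Dom C f).
      g \<cdot>\<^bsub>C\<^esub> f = Idt C (Dom C f) \<and> f \<cdot>\<^bsub>C\<^esub> g = Idt C (Cod C f))"

definition zero_object :: "('o, 'm, 'z) cat_scheme \<Rightarrow> 'o \<Rightarrow> bool" where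
  "zero_object C Z \<longleftrightarrow> Z \<in> Obj C \<and>
    (\<forall>X \<in> Obj C. (\<exists>!f. f \<in> Hom C X Z) \<and> (\<exists>!f. f \<in> Hom C Z X))"

record ('o1, 'm1, 'o2, 'm2) fctr =
  FObj :: "'o1 \<Rightarrow> 'o2"
  FArr :: "'m1 \<Rightarrow> 'm2"

locale cat_functor = C: category C + D: category D
  for C :: "('o1, 'm1, 'y) cat_scheme" and D :: "('o2, 'm2, 'z) cat_scheme" +
  fixes F :: "('o1, 'm1, 'o2, 'm2) fctr"
  assumes FObj_Obj: "X \<in> Obj C \<Longrightarrow> FObj F X \<in> Obj D"
    and FArr_Hom: "f \<in> Hom C X Y \<Longrightarrow> FArr F f \<in> Hom D (FObj F X) (FObj F Y)"
    and FArr_Idt: "X \<in> Obj C \<Longrightarrow> FArr F (Idt C X) = Idt D (FObj F X)"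
    and FArr_Comp: "f \<in> Hom C X Y \<Longrightarrow> g \<in> Hom C Y Z \<Longrightarrow>
      FArr F (g \<cdot>\<^bsub>C\<^esub> f) = FArr F g \<cdot>\<^bsub>D\<^esub> FArr F f"

definition id_fctr :: "('o, 'm, 'o, 'm) fctr" where
  "id_fctr = \<lparr>FObj = id, FArr = id\<rparr>"

definition comp_fctr ::
  "('o2, 'm2, 'o3, 'm3) fctr \<Rightarrow> ('o1, 'm1, 'o2, 'm2) fctr \<Rightarrow> ('o1, 'm1, 'o3, 'm3) fctr" where
  "comp_fctr G F = \<lparr>FObj = FObj G \<circ> FObj F, FArr = FArr G \<circ> FArr F\<rparr>"

definition naturally_isomorphic ::
  "('o1, 'm1, 'y) cat_scheme \<Rightarrow> ('o2, 'm2, 'z) cat_scheme \<Rightarrow>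
   ('o1, 'm1, 'o2, 'm2) fctr \<Rightarrow> ('o1, 'm1, 'o2, 'm2) fctr \<Rightarrow> bool" where
  "naturally_isomorphic C D F G \<longleftrightarrow>
    (\<exists>t. (\<forall>X \<in> Obj C. t X \<in> Hom D (FObj F X) (FObj G X) \<and> iso_arr D (t X)) \<and>
         (\<forall>f \<in> Arr C. t (Cod C f) \<cdot>\<^bsub>D\<^esub> FArr F f = FArr G f \<cdot>\<^bsub>D\<^esub> t (Dom C f)))"

definition cat_equivalence ::
  "('o1, 'm1, 'y) cat_scheme \<Rightarrow> ('o2, 'm2, 'z) cat_scheme \<Rightarrow> ('o1, 'm1, 'o2, 'm2) fctr \<Rightarrow> bool" where
  "cat_equivalence C D F \<longleftrightarrow> cat_functor C D F \<and>
    (\<exists>G. cat_functor D C G \<and> naturally_isomorphic C C id_fctr (comp_fctr G F) \<and>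
         naturally_isomorphic D D (comp_fctr F G) id_fctr)"

section \<open>Additive categories and ideals\<close>

text \<open>\<open>Zero C X Y\<close> is the zero of \<open>Hom C X Y\<close>; \<open>Add\<close> is meaningful on parallel arrows.\<close>

record ('o, 'm) addcat = "('o, 'm) cat" +
  Add :: "'m \<Rightarrow> 'm \<Rightarrow> 'm"  (infixl \<open>\<boxplus>\<index>\<close> 65)
  Zero :: "'o \<Rightarrow> 'o \<Rightarrow> 'm"

definition Hom_group :: "('o, 'm, 'z) addcat_scheme \<Rightarrow> 'o \<Rightarrow> 'o \<Rightarrow> 'm monoid" where
  "Hom_group C X Y = \<lparr>carrier = Hom C X Y, mult = Add C, one = Zero C X Y\<rparr>"

definition Neg :: "('o, 'm, 'z) addcat_scheme \<Rightarrow> 'm \<Rightarrow> 'm" where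
  "Neg C f = inv\<^bsub>Hom_group C (Dom C f) (Cod C f)\<^esub> f"

locale preadditive_category = category C
  for C :: "('o, 'm, 'z) addcat_scheme" (structure) +
  assumes Hom_comm_group: "X \<in> Obj C \<Longrightarrow> Y \<in> Obj C \<Longrightarrow> comm_group (Hom_group C X Y)"
    and Comp_Add_left: "f \<in> Hom C X Y \<Longrightarrow> g \<in> Hom C Y Z \<Longrightarrow> g' \<in> Hom C Y Z \<Longrightarrow>
      (g \<boxplus> g') \<cdot> f = (g \<cdot> f) \<boxplus> (g' \<cdot> f)"
    and Comp_Add_right: "f \<in> Hom C X Y \<Longrightarrow> f' \<in> Hom C X Y \<Longrightarrow> g \<in> Hom C Y Z \<Longrightarrow>
      g \<cdot> (f \<boxplus> f') = (g \<cdot> f) \<boxplus> (g \<cdot> f')"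

definition is_biproduct ::
  "('o, 'm, 'z) addcat_scheme \<Rightarrow> 'o \<Rightarrow> 'o \<Rightarrow> 'o \<Rightarrow> 'm \<Rightarrow> 'm \<Rightarrow> 'm \<Rightarrow> 'm \<Rightarrow> bool" where
  "is_biproduct C X Y S i j p q \<longleftrightarrow> S \<in> Obj C \<and>
    i \<in> Hom C X S \<and> j \<in> Hom C Y S \<and> p \<in> Hom C S X \<and> q \<in> Hom C S Y \<and>
    p \<cdot>\<^bsub>C\<^esub> i = Idt C X \<and> q \<cdot>\<^bsub>C\<^esub> j = Idt C Y \<and>
    p \<cdot>\<^bsub>C\<^esub> j = Zero C Y X \<and> q \<cdot>\<^bsub>C\<^esub> i = Zero C X Y \<and>
    (i \<cdot>\<^bsub>C\<^esub> p) \<boxplus>\<^bsub>C\<^esub> (j \<cdot>\<^bsub>C\<^esub> q) = Idt C S"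

locale additive_category = preadditive_category +
  assumes ex_zero_object: "\<exists>Z. zero_object C Z"
    and ex_biproduct: "X \<in> Obj C \<Longrightarrow> Y \<in> Obj C \<Longrightarrow> \<exists>S i j p q. is_biproduct C X Y S i j p q"

locale cat_ideal = preadditive_category +
  fixes I :: "'b set"
  assumes ideal_subset: "I \<subseteq> Arr C"
    and ideal_subgroup: "X \<in> Obj C \<Longrightarrow> Y \<in> Obj C \<Longrightarrow> subgroup (I \<inter> Hom C X Y) (Hom_group C X Y)"
    and ideal_Comp_left: "f \<in> I \<Longrightarrow> g \<in> Arr C \<Longrightarrow> Cod C f = Dom C g \<Longrightarrow> g \<cdot> f \<in> I"
    and ideal_Comp_right: "f \<in> Arr C \<Longrightarrow> g \<in> I \<Longrightarrow> Cod C f = Dom C g \<Longrightarrow> g \<cdot> f \<in> I"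

locale square_zero_ideal = cat_ideal +
  assumes square_zero:
    "f \<in> I \<Longrightarrow> g \<in> I \<Longrightarrow> Cod C f = Dom C g \<Longrightarrow> g \<cdot> f = Zero C (Dom C f) (Cod C g)"

definition fctr_kernel ::
  "('o1, 'm1, 'y) cat_scheme \<Rightarrow> ('o2, 'm2, 'z) addcat_scheme \<Rightarrow>
   ('o1, 'm1, 'o2, 'm2) fctr \<Rightarrow> 'm1 set" where
  "fctr_kernel C D F =
    {f \<in> Arr C. FArr F f = Zero D (FObj F (Dom C f)) (FObj F (Cod C f))}"

section \<open>Puppe triangulated categories\<close>

text \<open>A diagram \<open>X \<rightarrow> Y \<rightarrow> Z \<rightarrow> X[1]\<close> is encoded by its triple of arrows, which determine the objects.\<close>

record ('o, 'm) tricat = "('o, 'm) addcat" +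
  Shift :: "('o, 'm, 'o, 'm) fctr"
  Dist :: "('m \<times> 'm \<times> 'm) set"

definition tri_diagram :: "('o, 'm, 'z) tricat_scheme \<Rightarrow> 'm \<times> 'm \<times> 'm \<Rightarrow> bool" where
  "tri_diagram T = (\<lambda>(f, g, h).
    f \<in> Arr T \<and> g \<in> Arr T \<and> h \<in> Arr T \<and>
    Cod T f = Dom T g \<and> Cod T g = Dom T h \<and> Cod T h = FObj (Shift T) (Dom T f))"

definition tri_morphism ::
  "('o, 'm, 'z) tricat_scheme \<Rightarrow> 'm \<times> 'm \<times> 'm \<Rightarrow> 'm \<times> 'm \<times> 'm \<Rightarrow> 'm \<times> 'm \<times> 'm \<Rightarrow> bool" where
  "tri_morphism T = (\<lambda>(f, g, h) (f', g', h') (a, b, c).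
    a \<in> Hom T (Dom T f) (Dom T f') \<and>
    b \<in> Hom T (Dom T g) (Dom T g') \<and>
    c \<in> Hom T (Dom T h) (Dom T h') \<and>
    b \<cdot>\<^bsub>T\<^esub> f = f' \<cdot>\<^bsub>T\<^esub> a \<and>
    c \<cdot>\<^bsub>T\<^esub> g = g' \<cdot>\<^bsub>T\<^esub> b \<and>
    FArr (Shift T) a \<cdot>\<^bsub>T\<^esub> h = h' \<cdot>\<^bsub>T\<^esub> c)"

text \<open>Additivity of the shift is not an axiom: it follows from its being an equivalence of
  additive categories.\<close>

locale puppe_triangulated = additive_category T
  for T :: "('o, 'm, 'z) tricat_scheme" (structure) +
  assumes Shift_equivalence: "cat_equivalence T T (Shift T)"
    and Dist_diagram: "t \<in> Dist T \<Longrightarrow> tri_diagram T t"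
    and TR1: "t \<in> Dist T \<Longrightarrow> tri_diagram T t' \<Longrightarrow> tri_morphism T t t' (a, b, c) \<Longrightarrow>
      iso_arr T a \<Longrightarrow> iso_arr T b \<Longrightarrow> iso_arr T c \<Longrightarrow> t' \<in> Dist T"
    and TR2: "X \<in> Obj T \<Longrightarrow> zero_object T Z \<Longrightarrow>
      (Idt T X, Zero T X Z, Zero T Z (FObj (Shift T) X)) \<in> Dist T"
    and TR3: "(f, g, h) \<in> Dist T \<Longrightarrow> (g, h, Neg T (FArr (Shift T) f)) \<in> Dist T"
    and TR4: "f \<in> Arr T \<Longrightarrow> \<exists>g h. (f, g, h) \<in> Dist T"
    and TR5: "(f, g, h) \<in> Dist T \<Longrightarrow> (f', g', h') \<in> Dist T \<Longrightarrow>
      a \<in> Hom T (Dom T f) (Dom T f') \<Longrightarrow> b \<in> Hom T (Cod T f) (Cod T f') \<Longrightarrow>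
      b \<cdot> f = f' \<cdot> a \<Longrightarrow> \<exists>c. tri_morphism T (f, g, h) (f', g', h') (a, b, c)"

section \<open>The category of arrows and the category of chosen triangles\<close>

text \<open>An arrow of these categories records its source \<open>f\<close> and target \<open>f'\<close> alongside the
  components \<open>(a, b)\<close> resp. \<open>(a, b, c)\<close>, since the components alone do not determine them.
  Addition is componentwise.\<close>

definition arrow_cat :: "('o, 'm, 'z) addcat_scheme \<Rightarrow> ('m, ('m \<times> 'm) \<times> ('m \<times> 'm)) addcat" where
  "arrow_cat C =
    \<lparr>Obj = Arr C,
     Arr = {((f, f'), (a, b)) | f f' a b. f \<in> Arr C \<and> f' \<in> Arr C \<and>
       a \<in> Hom C (Dom C f) (Dom C f') \<and> b \<in> Hom C (Cod C f) (Cod C f') \<and>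
       b \<cdot>\<^bsub>C\<^esub> f = f' \<cdot>\<^bsub>C\<^esub> a},
     Dom = (\<lambda>((f, f'), _). f),
     Cod = (\<lambda>((f, f'), _). f'),
     Idt = (\<lambda>f. ((f, f), (Idt C (Dom C f), Idt C (Cod C f)))),
     Comp = (\<lambda>((_, f''), (a', b')) ((f, _), (a, b)). ((f, f''), (a' \<cdot>\<^bsub>C\<^esub> a, b' \<cdot>\<^bsub>C\<^esub> b))),
     Add = (\<lambda>((f, f'), (a, b)) (_, (a', b')). ((f, f'), (a \<boxplus>\<^bsub>C\<^esub> a', b \<boxplus>\<^bsub>C\<^esub> b'))),
     Zero = (\<lambda>f f'. ((f, f'), (Zero C (Dom C f) (Dom C f'), Zero C (Cod C f) (Cod C f'))))\<rparr>"

text \<open>The chosen triangle on \<open>f\<close> is \<open>(f, u f, v f)\<close>, with cone \<open>C\<^sub>f = Cod T (u f)\<close>.\<close>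

definition Triangles0 ::
  "('o, 'm, 'z) tricat_scheme \<Rightarrow> ('m \<Rightarrow> 'm) \<Rightarrow> ('m \<Rightarrow> 'm) \<Rightarrow>
   ('m, ('m \<times> 'm) \<times> ('m \<times> 'm \<times> 'm)) addcat" where
  "Triangles0 T u v =
    \<lparr>Obj = Arr T,
     Arr = {((f, f'), (a, b, c)) | f f' a b c. f \<in> Arr T \<and> f' \<in> Arr T \<and>
       tri_morphism T (f, u f, v f) (f', u f', v f') (a, b, c)},
     Dom = (\<lambda>((f, f'), _). f),
     Cod = (\<lambda>((f, f'), _). f'),
     Idt = (\<lambda>f. ((f, f), (Idt T (Dom T f), Idt T (Cod T f), Idt T (Cod T (u f))))),
     Comp = (\<lambda>((_, f''), (a', b', c')) ((f, _), (a, b, c)).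
       ((f, f''), (a' \<cdot>\<^bsub>T\<^esub> a, b' \<cdot>\<^bsub>T\<^esub> b, c' \<cdot>\<^bsub>T\<^esub> c))),
     Add = (\<lambda>((f, f'), (a, b, c)) (_, (a', b', c')).
       ((f, f'), (a \<boxplus>\<^bsub>T\<^esub> a', b \<boxplus>\<^bsub>T\<^esub> b', c \<boxplus>\<^bsub>T\<^esub> c'))),
     Zero = (\<lambda>f f'. ((f, f'), (Zero T (Dom T f) (Dom T f'), Zero T (Cod T f) (Cod T f'),
       Zero T (Cod T (u f)) (Cod T (u f')))))\<rparr>"

definition Triangles0_proj ::
  "('m, ('m \<times> 'm) \<times> ('m \<times> 'm \<times> 'm), 'm, ('m \<times> 'm) \<times> ('m \<times> 'm)) fctr" where
  "Triangles0_proj =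
    \<lparr>FObj = id, FArr = (\<lambda>((f, f'), (a, b, c)). ((f, f'), (a, b)))\<rparr>"

end

theory Submission
  imports Defs
begin

text \<open>If \<open>(0, 0, c)\<close> and \<open>(0, 0, c')\<close> are composable then \<open>v\<^sub>f\<^sub>' \<cdot> c = 0\<close> and \<open>c' \<cdot> u\<^sub>f\<^sub>' = 0\<close>.
  Since \<open>v\<^sub>f\<^sub>'\<close> is a weak cokernel of \<open>u\<^sub>f\<^sub>'\<close>, the second equation gives \<open>c' = e \<cdot> v\<^sub>f\<^sub>'\<close>, and
  then \<open>c' \<cdot> c = e \<cdot> v\<^sub>f\<^sub>' \<cdot> c = 0\<close>. The category of chosen triangles is preadditive because
  the shift, as an equivalence of additive categories, is additive.\<close>

section \<open>Preadditive categories\<close>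

lemma (in category) Hom_Obj:
  assumes "f \<in> Hom C X Y"
  shows "X \<in> Obj C" "Y \<in> Obj C"
  using assms Dom_Obj Cod_Obj unfolding Hom_def by auto

context preadditive_category
begin

lemma Zero_Hom: "X \<in> Obj C \<Longrightarrow> Y \<in> Obj C \<Longrightarrow> Zero C X Y \<in> Hom C X Y"
  using monoid.one_closed[OF group.is_monoid[OF comm_group.axioms(2)[OF Hom_comm_group]]]
  by (fastforce simp: Hom_group_def)

lemma Add_Hom:
  assumes "f \<in> Hom C X Y" "g \<in> Hom C X Y"
  shows "f \<boxplus> g \<in> Hom C X Y"
proof -
  interpret G: comm_group "Hom_group C X Y"
    using Hom_comm_group Hom_Obj[OF assms(1)] by blast
  show ?thesis using G.m_closed assms by (simp add: Hom_group_def)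
qed

lemma Add_assoc:
  assumes "f \<in> Hom C X Y" "g \<in> Hom C X Y" "h \<in> Hom C X Y"
  shows "f \<boxplus> g \<boxplus> h = f \<boxplus> (g \<boxplus> h)"
proof -
  interpret G: comm_group "Hom_group C X Y"
    using Hom_comm_group Hom_Obj[OF assms(1)] by blast
  show ?thesis using G.m_assoc assms by (simp add: Hom_group_def)
qed

lemma Add_commute:
  assumes "f \<in> Hom C X Y" "g \<in> Hom C X Y"
  shows "f \<boxplus> g = g \<boxplus> f"
proof -
  interpret G: comm_group "Hom_group C X Y"
    using Hom_comm_group Hom_Obj[OF assms(1)] by blast
  show ?thesis using G.m_comm assms by (simp add: Hom_group_def)
qed

lemma Add_Zero_left:
  assumes "f \<in> Hom C X Y"
  shows "Zero C X Y \<boxplus> f = f"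
proof -
  interpret G: comm_group "Hom_group C X Y"
    using Hom_comm_group Hom_Obj[OF assms(1)] by blast
  show ?thesis using G.l_one assms by (simp add: Hom_group_def)
qed

lemma Add_Zero_right: "f \<in> Hom C X Y \<Longrightarrow> f \<boxplus> Zero C X Y = f"
  using Add_Zero_left Add_commute Hom_Obj Zero_Hom by metis

lemma Neg_Hom:
  assumes "f \<in> Hom C X Y"
  shows "Neg C f \<in> Hom C X Y"
proof -
  interpret G: comm_group "Hom_group C X Y"
    using Hom_comm_group Hom_Obj[OF assms(1)] by blast
  show ?thesis using G.inv_closed[of f] assms by (auto simp: Hom_group_def Neg_def Hom_def)
qed

lemma Add_Neg_left:
  assumes "f \<in> Hom C X Y"
  shows "Neg C f \<boxplus> f = Zero C X Y"
proof -
  interpret G: comm_group "Hom_group C X Y"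
    using Hom_comm_group Hom_Obj[OF assms(1)] by blast
  show ?thesis using G.l_inv[of f] assms by (auto simp: Hom_group_def Neg_def Hom_def)
qed

lemma Neg_unique:
  assumes "f \<in> Hom C X Y" "g \<in> Hom C X Y" "g \<boxplus> f = Zero C X Y"
  shows "g = Neg C f"
proof -
  interpret G: comm_group "Hom_group C X Y"
    using Hom_comm_group Hom_Obj[OF assms(1)] by blast
  show ?thesis using G.inv_equality[of g f] assms by (auto simp: Hom_group_def Neg_def Hom_def)
qed

text \<open>Add \<open>Neg C f\<close> on the left of \<open>f \<boxplus> f = f\<close>. This is how
  composites with a zero arrow are shown to vanish.\<close>

lemma Add_idem_Zero:
  assumes "f \<in> Hom C X Y" "f \<boxplus> f = f"
  shows "f = Zero C X Y"
  using assms by (metis Add_Neg_left Add_Zero_left Add_assoc Neg_Hom)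

text \<open>Distributivity turns 0 + 0 = 0 into 0 f + 0 f = 0 f, so 0 f is idempotent for addition
  and hence zero. \<open>Comp_Zero_right\<close> is the mirror image.\<close>

lemma Comp_Zero_left:
  assumes "f \<in> Hom C X Y" "Z \<in> Obj C"
  shows "Zero C Y Z \<cdot> f = Zero C X Z"
proof -
  have z: "Zero C Y Z \<in> Hom C Y Z"
    using assms Zero_Hom Hom_Obj by blast
  show ?thesis
    using Add_idem_Zero[OF Comp_Hom[OF assms(1) z]] Comp_Add_left[OF assms(1) z z]
      Add_Zero_left[OF z] by simp
qed

lemma Comp_Zero_right:
  assumes "f \<in> Hom C X Y" "W \<in> Obj C"
  shows "f \<cdot> Zero C W X = Zero C W Y"
proof -
  have z: "Zero C W X \<in> Hom C W X"
    using assms Zero_Hom Hom_Obj by blast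
  show ?thesis
    using Add_idem_Zero[OF Comp_Hom[OF z assms(1)]] Comp_Add_right[OF z z assms(1)]
      Add_Zero_left[OF z] by simp
qed

lemma Comp_Neg_left:
  assumes "f \<in> Hom C X Y" "g \<in> Hom C Y Z"
  shows "Neg C g \<cdot> f = Neg C (g \<cdot> f)"
proof -
  note n = Neg_Hom[OF assms(2)]
  have "Neg C g \<cdot> f \<boxplus> g \<cdot> f = Zero C X Z"
    using Comp_Add_left[OF assms(1) n assms(2)] Add_Neg_left[OF assms(2)]
      Comp_Zero_left[OF assms(1)] Hom_Obj[OF assms(2)] by simp
  then show ?thesis
    using Neg_unique Comp_Hom assms n by blast
qed

lemma Comp_Neg_right:
  assumes "f \<in> Hom C X Y" "g \<in> Hom C Y Z"
  shows "g \<cdot> Neg C f = Neg C (g \<cdot> f)"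
proof -
  note n = Neg_Hom[OF assms(1)]
  have "g \<cdot> Neg C f \<boxplus> g \<cdot> f = Zero C X Z"
    using Comp_Add_right[OF n assms(1) assms(2)] Add_Neg_left[OF assms(1)]
      Comp_Zero_right[OF assms(2)] Hom_Obj[OF assms(1)] by simp
  then show ?thesis
    using Neg_unique Comp_Hom assms n by blast
qed

lemma Neg_Neg: "f \<in> Hom C X Y \<Longrightarrow> Neg C (Neg C f) = f"
  by (metis Add_Neg_left Add_commute Neg_Hom Neg_unique)

end

section \<open>Equivalences are additive\<close>

lemma (in category) comp_iso_cancel_left:
  assumes "iso_arr C t" "t \<in> Hom C X Y" "f \<in> Hom C W X" "g \<in> Hom C W X" "t \<cdot> f = t \<cdot> g"
  shows "f = g"
proof -
  obtain r where r: "r \<in> Hom C Y X" "r \<cdot> t = Idt C X"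
    using assms(1,2) unfolding iso_arr_def Hom_def by auto
  show ?thesis
    using Comp_assoc[OF assms(3,2) r(1)] Comp_assoc[OF assms(4,2) r(1)] assms(5) r(2)
      Comp_Idt_left[OF assms(3)] Comp_Idt_left[OF assms(4)] by metis
qed

lemma (in category) comp_iso_cancel_right:
  assumes "iso_arr C t" "t \<in> Hom C X Y" "f \<in> Hom C Y Z" "g \<in> Hom C Y Z" "f \<cdot> t = g \<cdot> t"
  shows "f = g"
proof -
  obtain r where r: "r \<in> Hom C Y X" "t \<cdot> r = Idt C Y"
    using assms(1,2) unfolding iso_arr_def Hom_def by auto
  show ?thesis
    using Comp_assoc[OF r(1) assms(2,3)] Comp_assoc[OF r(1) assms(2,4)] assms(5) r(2)
      Comp_Idt_right[OF assms(3)] Comp_Idt_right[OF assms(4)] by metis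
qed

text \<open>By naturality f t_X = t_Y H(f), so H(f) determines f t_X, and the isomorphism t_X can be
  cancelled.\<close>

lemma (in category) faithful_of_naturally_isomorphic_id:
  assumes "naturally_isomorphic C C H id_fctr" "f \<in> Hom C X Y" "g \<in> Hom C X Y"
    and "FArr H f = FArr H g"
  shows "f = g"
proof -
  obtain t where t: "\<And>X. X \<in> Obj C \<Longrightarrow> t X \<in> Hom C (FObj H X) X \<and> iso_arr C (t X)"
    and nat: "\<And>f. f \<in> Arr C \<Longrightarrow> t (Cod C f) \<cdot> FArr H f = f \<cdot> t (Dom C f)"
    using assms(1) unfolding naturally_isomorphic_def id_fctr_def by auto
  have "f \<cdot> t X = g \<cdot> t X"
    using nat[of f] nat[of g] assms(2-4) unfolding Hom_def by simp
  then show ?thesis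
    using comp_iso_cancel_right t assms(2,3) Hom_Obj(1)[OF assms(2)] by blast
qed

text \<open>Taking \<open>P = {}\<close> says that terminality is preserved; taking for \<open>P\<close> the two projections of a
  biproduct is what makes equivalences additive.\<close>

lemma equivalence_preserves_jointly_monic:
  assumes "cat_equivalence C D F"
    and S: "S \<in> Obj C"
    and P: "\<And>p. p \<in> P \<Longrightarrow> p \<in> Arr C \<and> Dom C p = S"
    and jm: "\<And>W x y. x \<in> Hom C W S \<Longrightarrow> y \<in> Hom C W S \<Longrightarrow>
      (\<And>p. p \<in> P \<Longrightarrow> p \<cdot>\<^bsub>C\<^esub> x = p \<cdot>\<^bsub>C\<^esub> y) \<Longrightarrow> x = y"
    and x: "x \<in> Hom D W (FObj F S)" and y: "y \<in> Hom D W (FObj F S)"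
    and eq: "\<And>p. p \<in> P \<Longrightarrow> FArr F p \<cdot>\<^bsub>D\<^esub> x = FArr F p \<cdot>\<^bsub>D\<^esub> y"
  shows "x = y"
proof -
  interpret F: cat_functor C D F using assms(1) unfolding cat_equivalence_def by blast
  obtain G where "cat_functor D C G"
    and unit: "naturally_isomorphic C C id_fctr (comp_fctr G F)"
    and counit: "naturally_isomorphic D D (comp_fctr F G) id_fctr"
    using assms(1) unfolding cat_equivalence_def by blast
  then interpret G: cat_functor D C G by blast
  obtain t where t: "\<And>X. X \<in> Obj C \<Longrightarrow> t X \<in> Hom C X (FObj G (FObj F X)) \<and> iso_arr C (t X)"
    and nat: "\<And>f. f \<in> Arr C \<Longrightarrow>
      t (Cod C f) \<cdot>\<^bsub>C\<^esub> f = FArr G (FArr F f) \<cdot>\<^bsub>C\<^esub> t (Dom C f)"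
    using unit unfolding naturally_isomorphic_def id_fctr_def comp_fctr_def by auto
  obtain r where r: "r \<in> Hom C (FObj G (FObj F S)) S"
    "r \<cdot>\<^bsub>C\<^esub> t S = Idt C S" "t S \<cdot>\<^bsub>C\<^esub> r = Idt C (FObj G (FObj F S))"
    using t[OF S] unfolding iso_arr_def Hom_def by auto
  note tS = conjunct1[OF t[OF S]]
  have Gx: "FArr G x \<in> Hom C (FObj G W) (FObj G (FObj F S))"
    and Gy: "FArr G y \<in> Hom C (FObj G W) (FObj G (FObj F S))"
    using G.FArr_Hom x y by blast+
  have t_r: "t S \<cdot>\<^bsub>C\<^esub> (r \<cdot>\<^bsub>C\<^esub> z) = z" if "z \<in> Hom C V (FObj G (FObj F S))" for z V
    using F.C.Comp_assoc[OF that r(1) tS] r(3) F.C.Comp_Idt_left[OF that] by simp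
  \<comment> \<open>The arrows \<open>x\<close> and \<open>y\<close> live in \<open>D\<close>, while
    joint monicity is known in \<open>C\<close>. Applying \<open>G\<close> and then the inverse
    \<open>r\<close> of the unit component \<open>t S\<close> produces arrows into \<open>S\<close>,
    which can be tested against \<open>P\<close>.\<close>
  have "r \<cdot>\<^bsub>C\<^esub> FArr G x = r \<cdot>\<^bsub>C\<^esub> FArr G y"
  proof (rule jm)
    show rx: "r \<cdot>\<^bsub>C\<^esub> FArr G x \<in> Hom C (FObj G W) S"
      and ry: "r \<cdot>\<^bsub>C\<^esub> FArr G y \<in> Hom C (FObj G W) S"
      using F.C.Comp_Hom Gx Gy r(1) by blast+
    fix p assume "p \<in> P"
    define Y where "Y = Cod C p"
    have p: "p \<in> Hom C S Y" using P[OF \<open>p \<in> P\<close>] unfolding Y_def Hom_def by blast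
    note Fp = F.FArr_Hom[OF p]
    note GFp = G.FArr_Hom[OF Fp]
    have Y: "Y \<in> Obj C" using F.C.Hom_Obj[OF p] by blast
    note tY = conjunct1[OF t[OF Y]]
    have natp: "t Y \<cdot>\<^bsub>C\<^esub> p = FArr G (FArr F p) \<cdot>\<^bsub>C\<^esub> t S"
      using nat[of p] p unfolding Hom_def by auto
    \<comment> \<open>Naturality of the unit moves \<open>p\<close> to G(F(p)), the factor t_S r
      disappears, and functoriality of \<open>G\<close> gathers the rest into G(F(p) z). The
      hypothesis \<open>eq\<close> then applies inside \<open>G\<close>.\<close>
    have transport: "t Y \<cdot>\<^bsub>C\<^esub> (p \<cdot>\<^bsub>C\<^esub> (r \<cdot>\<^bsub>C\<^esub> FArr G z)) = FArr G (FArr F p \<cdot>\<^bsub>D\<^esub> z)"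
      if z: "z \<in> Hom D W (FObj F S)" for z
    proof -
      note Gz = G.FArr_Hom[OF z]
      note rz = F.C.Comp_Hom[OF Gz r(1)]
      have "t Y \<cdot>\<^bsub>C\<^esub> (p \<cdot>\<^bsub>C\<^esub> (r \<cdot>\<^bsub>C\<^esub> FArr G z)) = (t Y \<cdot>\<^bsub>C\<^esub> p) \<cdot>\<^bsub>C\<^esub> (r \<cdot>\<^bsub>C\<^esub> FArr G z)"
        using F.C.Comp_assoc[OF rz p tY] by simp
      also have "\<dots> = FArr G (FArr F p) \<cdot>\<^bsub>C\<^esub> FArr G z"
        using natp F.C.Comp_assoc[OF rz tS GFp] t_r[OF Gz] by simp
      finally show ?thesis using G.FArr_Comp[OF z Fp] by simp
    qed
    show "p \<cdot>\<^bsub>C\<^esub> (r \<cdot>\<^bsub>C\<^esub> FArr G x) = p \<cdot>\<^bsub>C\<^esub> (r \<cdot>\<^bsub>C\<^esub> FArr G y)"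
    proof (rule F.C.comp_iso_cancel_left)
      show "iso_arr C (t Y)" using t[OF Y] by blast
      show "t Y \<cdot>\<^bsub>C\<^esub> (p \<cdot>\<^bsub>C\<^esub> (r \<cdot>\<^bsub>C\<^esub> FArr G x)) = t Y \<cdot>\<^bsub>C\<^esub> (p \<cdot>\<^bsub>C\<^esub> (r \<cdot>\<^bsub>C\<^esub> FArr G y))"
        using transport x y eq[OF \<open>p \<in> P\<close>] by simp
    qed (use tY F.C.Comp_Hom rx ry p in blast)+
  qed
  then have "FArr G x = FArr G y" using t_r[OF Gx] t_r[OF Gy] by metis
  \<comment> \<open>The counit makes the composite of \<open>F\<close> after \<open>G\<close>
    faithful, so equality of G(x) and G(y) suffices.\<close>
  then have "FArr (comp_fctr F G) x = FArr (comp_fctr F G) y" by (simp add: comp_fctr_def)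
  then show "x = y"
    using F.D.faithful_of_naturally_isomorphic_id[OF counit x y] by blast
qed

text \<open>The zero object and the biproducts are taken in the source \<open>C\<close>;
  \<open>F\<close> carries them over to \<open>D\<close>. The case of interest is the shift, with
  both categories equal to \<open>T\<close>.\<close>

locale additive_equivalence = C: additive_category C + D: preadditive_category D
  for C :: "('o1, 'm1, 'y) addcat_scheme" and D :: "('o2, 'm2, 'z) addcat_scheme" +
  fixes F :: "('o1, 'm1, 'o2, 'm2) fctr"
  assumes equivalence: "cat_equivalence C D F"

sublocale additive_equivalence \<subseteq> cat_functor C D F
  using equivalence unfolding cat_equivalence_def by blast

section \<open>Zero arrows, biproducts, sums and negatives under an equivalence\<close>

context additive_equivalence
begin

text \<open>A zero arrow factors through a zero object \<open>Z\<close>. The empty family is jointly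
  monic on \<open>Z\<close>, hence also on F(Z), so F sends X \<rightarrow> Z to the zero arrow;
  composing with the image of Z \<rightarrow> Y keeps it zero.\<close>

lemma FArr_Zero:
  assumes X: "X \<in> Obj C" and Y: "Y \<in> Obj C"
  shows "FArr F (Zero C X Y) = Zero D (FObj F X) (FObj F Y)"
proof -
  obtain Z where "zero_object C Z" using C.ex_zero_object by blast
  then have Z: "Z \<in> Obj C" and terminal: "\<And>W x y. x \<in> Hom C W Z \<Longrightarrow> y \<in> Hom C W Z \<Longrightarrow> x = y"
    unfolding zero_object_def using C.Hom_Obj by blast+
  note a = C.Zero_Hom[OF X Z] and b = C.Zero_Hom[OF Z Y]
  have FX: "FObj F X \<in> Obj D" and FZ: "FObj F Z \<in> Obj D"
    using FObj_Obj X Z by blast+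
  have "FArr F (Zero C X Z) = Zero D (FObj F X) (FObj F Z)"
    using equivalence_preserves_jointly_monic[OF equivalence Z, where P = "{}",
        OF _ _ FArr_Hom[OF a] D.Zero_Hom[OF FX FZ]] terminal by blast
  then show ?thesis
    using FArr_Comp[OF a b] C.Comp_Zero_left[OF a Y] D.Comp_Zero_right[OF FArr_Hom[OF b] FX]
    by simp
qed

text \<open>The identities without a sum follow from functoriality and \<open>FArr_Zero\<close>. The
  remaining one cannot be obtained by applying F to a sum, as additivity is what is to be proved;
  instead both of its sides have the same composites with F(p) and F(q), which are jointly
  monic.\<close>

lemma FArr_biproduct:
  assumes "is_biproduct C X Y S i j p q"
  shows "is_biproduct D (FObj F X) (FObj F Y) (FObj F S) (FArr F i) (FArr F j) (FArr F p) (FArr F q)"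
proof -
  have S: "S \<in> Obj C" and i: "i \<in> Hom C X S" and j: "j \<in> Hom C Y S"
    and p: "p \<in> Hom C S X" and q: "q \<in> Hom C S Y"
    and e: "p \<cdot>\<^bsub>C\<^esub> i = Idt C X" "q \<cdot>\<^bsub>C\<^esub> j = Idt C Y"
      "p \<cdot>\<^bsub>C\<^esub> j = Zero C Y X" "q \<cdot>\<^bsub>C\<^esub> i = Zero C X Y"
      "(i \<cdot>\<^bsub>C\<^esub> p) \<boxplus>\<^bsub>C\<^esub> (j \<cdot>\<^bsub>C\<^esub> q) = Idt C S"
    using assms unfolding is_biproduct_def by blast+
  have X: "X \<in> Obj C" and Y: "Y \<in> Obj C" using C.Hom_Obj p q by blast+
  note Fi = FArr_Hom[OF i] and Fj = FArr_Hom[OF j] and Fp = FArr_Hom[OF p] and Fq = FArr_Hom[OF q]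
  have Fe: "FArr F p \<cdot>\<^bsub>D\<^esub> FArr F i = Idt D (FObj F X)" "FArr F q \<cdot>\<^bsub>D\<^esub> FArr F j = Idt D (FObj F Y)"
      "FArr F p \<cdot>\<^bsub>D\<^esub> FArr F j = Zero D (FObj F Y) (FObj F X)"
      "FArr F q \<cdot>\<^bsub>D\<^esub> FArr F i = Zero D (FObj F X) (FObj F Y)"
    using FArr_Comp[OF i p] FArr_Comp[OF j q] FArr_Comp[OF j p] FArr_Comp[OF i q] e
      FArr_Idt FArr_Zero X Y by simp_all
  note ip = D.Comp_Hom[OF Fp Fi] and jq = D.Comp_Hom[OF Fq Fj]
  let ?x = "(FArr F i \<cdot>\<^bsub>D\<^esub> FArr F p) \<boxplus>\<^bsub>D\<^esub> (FArr F j \<cdot>\<^bsub>D\<^esub> FArr F q)"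
  have FS: "FObj F S \<in> Obj D" and FX: "FObj F X \<in> Obj D" and FY: "FObj F Y \<in> Obj D"
    using FObj_Obj S X Y by blast+
  have "?x = Idt D (FObj F S)"
  proof (rule equivalence_preserves_jointly_monic[OF equivalence S, where P = "{p, q}"])
    show "p' \<in> Arr C \<and> Dom C p' = S" if "p' \<in> {p, q}" for p'
      using that p q unfolding Hom_def by auto
    show "?x \<in> Hom D (FObj F S) (FObj F S)" using D.Add_Hom ip jq by blast
    show "Idt D (FObj F S) \<in> Hom D (FObj F S) (FObj F S)" using D.Idt_Hom FS by blast
    show "x = y" if x: "x \<in> Hom C W S" and y: "y \<in> Hom C W S"
      and eq: "\<And>p'. p' \<in> {p, q} \<Longrightarrow> p' \<cdot>\<^bsub>C\<^esub> x = p' \<cdot>\<^bsub>C\<^esub> y" for W x y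
    proof -
      \<comment> \<open>Inserting ip + jq = id shows that an arrow into \<open>S\<close> is
        recovered from its two components, so \<open>p\<close> and \<open>q\<close> are jointly
        monic.\<close>
      have "z = i \<cdot>\<^bsub>C\<^esub> (p \<cdot>\<^bsub>C\<^esub> z) \<boxplus>\<^bsub>C\<^esub> j \<cdot>\<^bsub>C\<^esub> (q \<cdot>\<^bsub>C\<^esub> z)" if z: "z \<in> Hom C W S" for z
        using C.Comp_Add_left[OF z C.Comp_Hom[OF p i] C.Comp_Hom[OF q j]] e(5)
          C.Comp_Idt_left[OF z] C.Comp_assoc[OF z p i] C.Comp_assoc[OF z q j] by simp
      from this[OF x] this[OF y] show ?thesis using eq by (metis insertCI)
    qed
    show "FArr F p' \<cdot>\<^bsub>D\<^esub> ?x = FArr F p' \<cdot>\<^bsub>D\<^esub> Idt D (FObj F S)" if "p' \<in> {p, q}" for p'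
    proof -
      have "FArr F p \<cdot>\<^bsub>D\<^esub> ?x = FArr F p"
        using D.Comp_Add_right[OF ip jq Fp] D.Comp_assoc[OF Fp Fi Fp] D.Comp_assoc[OF Fq Fj Fp] Fe
          D.Comp_Idt_left[OF Fp] D.Comp_Zero_left[OF Fq FX] D.Add_Zero_right[OF Fp] by simp
      moreover have "FArr F q \<cdot>\<^bsub>D\<^esub> ?x = FArr F q"
        using D.Comp_Add_right[OF ip jq Fq] D.Comp_assoc[OF Fp Fi Fq] D.Comp_assoc[OF Fq Fj Fq] Fe
          D.Comp_Idt_left[OF Fq] D.Comp_Zero_left[OF Fp FY] D.Add_Zero_left[OF Fq] by simp
      ultimately show ?thesis
        using that D.Comp_Idt_right[OF Fp] D.Comp_Idt_right[OF Fq] by auto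
    qed
  qed
  then show ?thesis
    unfolding is_biproduct_def using FS Fi Fj Fp Fq Fe by blast
qed

text \<open>Addition is expressed by biproduct data: f + g is the composite of the pairing
  \<open>h\<close> = if + jg into Y \<oplus> Y with the codiagonal \<open>n\<close> = p + q. Since F
  preserves the biproduct, it preserves this composite description.\<close>

lemma FArr_Add:
  assumes f: "f \<in> Hom C X Y" and g: "g \<in> Hom C X Y"
  shows "FArr F (f \<boxplus>\<^bsub>C\<^esub> g) = FArr F f \<boxplus>\<^bsub>D\<^esub> FArr F g"
proof -
  have X: "X \<in> Obj C" and Y: "Y \<in> Obj C" using C.Hom_Obj f by blast+
  obtain S i j p q where bi: "is_biproduct C Y Y S i j p q"
    using C.ex_biproduct[OF Y Y] by blast
  have i: "i \<in> Hom C Y S" and j: "j \<in> Hom C Y S"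
    and p: "p \<in> Hom C S Y" and q: "q \<in> Hom C S Y"
    and e: "p \<cdot>\<^bsub>C\<^esub> i = Idt C Y" "q \<cdot>\<^bsub>C\<^esub> j = Idt C Y"
      "p \<cdot>\<^bsub>C\<^esub> j = Zero C Y Y" "q \<cdot>\<^bsub>C\<^esub> i = Zero C Y Y"
    using bi unfolding is_biproduct_def by blast+
  define h where "h = i \<cdot>\<^bsub>C\<^esub> f \<boxplus>\<^bsub>C\<^esub> j \<cdot>\<^bsub>C\<^esub> g"
  define n where "n = p \<boxplus>\<^bsub>C\<^esub> q"
  note if' = C.Comp_Hom[OF f i] and jg = C.Comp_Hom[OF g j]
  have h: "h \<in> Hom C X S" and n: "n \<in> Hom C S Y"
    unfolding h_def n_def using C.Add_Hom if' jg p q by blast+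
  have ph: "p \<cdot>\<^bsub>C\<^esub> h = f" and qh: "q \<cdot>\<^bsub>C\<^esub> h = g"
    unfolding h_def
    using C.Comp_Add_right[OF if' jg p] C.Comp_Add_right[OF if' jg q]
      C.Comp_assoc[OF f i p] C.Comp_assoc[OF g j p] C.Comp_assoc[OF f i q] C.Comp_assoc[OF g j q]
      e C.Comp_Idt_left[OF f] C.Comp_Idt_left[OF g] C.Comp_Zero_left[OF f Y]
      C.Comp_Zero_left[OF g Y] C.Add_Zero_left[OF g] C.Add_Zero_right[OF f] by simp_all
  have IY: "Idt C Y \<in> Hom C Y Y" using C.Idt_Hom Y by blast
  have ni: "n \<cdot>\<^bsub>C\<^esub> i = Idt C Y" and nj: "n \<cdot>\<^bsub>C\<^esub> j = Idt C Y"
    unfolding n_def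
    using C.Comp_Add_left[OF i p q] C.Comp_Add_left[OF j p q] e
      C.Add_Zero_left[OF IY] C.Add_Zero_right[OF IY] by simp_all
  have nh: "n \<cdot>\<^bsub>C\<^esub> h = f \<boxplus>\<^bsub>C\<^esub> g"
    unfolding n_def using C.Comp_Add_left[OF h p q] ph qh by simp
  note F = FArr_Hom[OF h] FArr_Hom[OF i] FArr_Hom[OF j] FArr_Hom[OF p] FArr_Hom[OF q]
    FArr_Hom[OF n] FArr_Hom[OF f] FArr_Hom[OF g]
  note ip = D.Comp_Hom[OF F(4) F(2)] and jq = D.Comp_Hom[OF F(5) F(3)]
  have FS: "(FArr F i \<cdot>\<^bsub>D\<^esub> FArr F p) \<boxplus>\<^bsub>D\<^esub> (FArr F j \<cdot>\<^bsub>D\<^esub> FArr F q) = Idt D (FObj F S)"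
    using FArr_biproduct[OF bi] unfolding is_biproduct_def by blast
  \<comment> \<open>Insert the decomposition \<open>FS\<close> of the identity of F(S) in front of
    F(h). For \<open>n\<close> only its values on \<open>i\<close> and \<open>j\<close> are
    computed, so that F(p + q) never has to be expanded.\<close>
  have "FArr F h = FArr F i \<cdot>\<^bsub>D\<^esub> FArr F f \<boxplus>\<^bsub>D\<^esub> FArr F j \<cdot>\<^bsub>D\<^esub> FArr F g"
    using D.Comp_Add_left[OF F(1) ip jq] FS D.Comp_Idt_left[OF F(1)]
      D.Comp_assoc[OF F(1) F(4) F(2)] D.Comp_assoc[OF F(1) F(5) F(3)]
      FArr_Comp[OF h p] FArr_Comp[OF h q] ph qh by simp
  moreover have "FArr F n \<cdot>\<^bsub>D\<^esub> (FArr F i \<cdot>\<^bsub>D\<^esub> FArr F f) = FArr F f"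
    using D.Comp_assoc[OF F(7) F(2) F(6)] FArr_Comp[OF i n] ni FArr_Idt[OF Y]
      D.Comp_Idt_left[OF F(7)] by simp
  moreover have "FArr F n \<cdot>\<^bsub>D\<^esub> (FArr F j \<cdot>\<^bsub>D\<^esub> FArr F g) = FArr F g"
    using D.Comp_assoc[OF F(8) F(3) F(6)] FArr_Comp[OF j n] nj FArr_Idt[OF Y]
      D.Comp_Idt_left[OF F(8)] by simp
  ultimately show ?thesis
    using FArr_Comp[OF h n] nh
      D.Comp_Add_right[OF D.Comp_Hom[OF F(7) F(2)] D.Comp_Hom[OF F(8) F(3)] F(6)] by simp
qed

lemma FArr_Neg:
  assumes f: "f \<in> Hom C X Y"
  shows "FArr F (Neg C f) = Neg D (FArr F f)"
proof (rule D.Neg_unique)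
  show "FArr F (Neg C f) \<boxplus>\<^bsub>D\<^esub> FArr F f = Zero D (FObj F X) (FObj F Y)"
    using FArr_Add[OF C.Neg_Hom[OF f] f] C.Add_Neg_left[OF f] FArr_Zero C.Hom_Obj[OF f] by simp
qed (use FArr_Hom f C.Neg_Hom in blast)+

end

section \<open>Puppe triangulated categories\<close>

text \<open>Provides additivity of the shift, which enters through the third square of a morphism of
  triangles, the only one that involves a[1].\<close>

sublocale puppe_triangulated \<subseteq> Shift: additive_equivalence T T "Shift T"
  by unfold_locales (rule Shift_equivalence)

context puppe_triangulated
begin

text \<open>Rotating the triangle of \<open>id\<^sub>V\<close> twice gives \<open>0 \<rightarrow> V[1] \<rightarrow> V[1]\<close> with second map \<open>-id\<close>. The
  object \<open>W\<close> has to be replaced by an isomorphic \<open>V[1]\<close> because triangles rotate only one way.\<close>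

lemma weak_cokernel:
  assumes dist: "(f, g, h) \<in> Dist T" and k: "k \<in> Hom T (Cod T f) W"
    and kf: "k \<cdot> f = Zero T (Dom T f) W"
  obtains e where "e \<in> Hom T (Cod T g) W" "k = e \<cdot> g"
proof -
  have diag: "f \<in> Arr T" "g \<in> Arr T" "h \<in> Arr T" "Cod T f = Dom T g" "Cod T g = Dom T h"
    using Dist_diagram[OF dist] unfolding tri_diagram_def by auto
  have f: "f \<in> Hom T (Dom T f) (Cod T f)" and g: "g \<in> Hom T (Cod T f) (Cod T g)"
    using diag unfolding Hom_def by auto
  have X: "Dom T f \<in> Obj T" and W: "W \<in> Obj T" using Hom_Obj f k by blast+
  obtain G where "cat_functor T T G"
    and "naturally_isomorphic T T (comp_fctr (Shift T) G) id_fctr"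
    using Shift_equivalence unfolding cat_equivalence_def by blast
  \<comment> \<open>The isomorphism \<open>s\<close> from V[1] to \<open>W\<close> is the counit
    component of the shift equivalence at \<open>W\<close>, where V is the image of \<open>W\<close>
    under the quasi-inverse \<open>G\<close>.\<close>
  then obtain s where V: "FObj G W \<in> Obj T" and s: "s \<in> Hom T (FObj (Shift T) (FObj G W)) W"
    and "iso_arr T s"
    unfolding naturally_isomorphic_def comp_fctr_def id_fctr_def
    using W cat_functor.FObj_Obj by fastforce
  define V where "V = FObj G W"
  define S where "S = FObj (Shift T) V"
  note V = V[folded V_def] and s = s[folded V_def, folded S_def]
  have S: "S \<in> Obj T" using Hom_Obj s by blast
  obtain r where r: "r \<in> Hom T W S" and sr: "s \<cdot> r = Idt T W"
    using \<open>iso_arr T s\<close> s unfolding iso_arr_def Hom_def by auto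
  obtain Z where Zz: "zero_object T Z" using ex_zero_object by blast
  then have Z: "Z \<in> Obj T" unfolding zero_object_def by blast
  \<comment> \<open>The minus sign left behind by \<open>TR3\<close>. As \<open>N\<close> is its own
    inverse, it can be undone at the end.\<close>
  define N where "N = Neg T (Idt T S)"
  have I: "Idt T S \<in> Hom T S S" and N: "N \<in> Hom T S S"
    unfolding N_def using Idt_Hom Neg_Hom S by blast+
  have NN: "N \<cdot> N = Idt T S"
    using Comp_Neg_left[OF N I] Comp_Idt_left[OF N] Neg_Neg[OF I] N_def by simp
  \<comment> \<open>The first rotation gives V \<rightarrow> Z \<rightarrow> V[1] \<rightarrow> V[1]
    ending in -id, the second Z \<rightarrow> V[1] \<rightarrow> V[1] \<rightarrow> Z[1] with -id in
    the middle.\<close>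
  have d: "(Zero T Z S, N, Neg T (FArr (Shift T) (Zero T V Z))) \<in> Dist T"
    using TR3[OF TR3[OF TR2[OF V Zz]]] Shift.FArr_Idt[OF V] unfolding N_def S_def by simp
  have n: "Neg T (FArr (Shift T) (Zero T V Z)) \<in> Hom T S (FObj (Shift T) Z)"
    unfolding S_def using Neg_Hom Shift.FArr_Hom Zero_Hom V Z by blast
  note zs = Zero_Hom[OF Z S] and xz = Zero_Hom[OF X Z] and rk = Comp_Hom[OF k r]
  \<comment> \<open>The hypothesis \<open>kf\<close> says exactly that \<open>r \<cdot> k\<close>
    and the zero arrow into \<open>Z\<close> form a commutative square between the first maps of the
    two triangles, as \<open>TR5\<close> requires.\<close>
  have "(r \<cdot> k) \<cdot> f = Zero T Z S \<cdot> Zero T (Dom T f) Z"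
    using Comp_assoc[OF f k r] kf Comp_Zero_right[OF r X] Comp_Zero_left[OF xz S] by simp
  then obtain c where "tri_morphism T (f, g, h)
      (Zero T Z S, N, Neg T (FArr (Shift T) (Zero T V Z))) (Zero T (Dom T f) Z, r \<cdot> k, c)"
    using TR5[OF dist d, of "Zero T (Dom T f) Z" "r \<cdot> k"] xz rk zs unfolding Hom_def by auto
  then have c: "c \<in> Hom T (Cod T g) S" and cg: "c \<cdot> g = N \<cdot> (r \<cdot> k)"
    using n diag unfolding tri_morphism_def Hom_def by auto
  have Nc: "N \<cdot> c \<in> Hom T (Cod T g) S" using Comp_Hom c N by blast
  \<comment> \<open>The factorisation is e = s N c: \<open>N\<close> cancels the sign in
    \<open>cg\<close>, and \<open>s\<close> cancels \<open>r\<close>.\<close>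
  have "(s \<cdot> (N \<cdot> c)) \<cdot> g = s \<cdot> (N \<cdot> (N \<cdot> (r \<cdot> k)))"
    using Comp_assoc[OF g Nc s] Comp_assoc[OF g c N] cg by simp
  also have "\<dots> = s \<cdot> (r \<cdot> k)"
    using Comp_assoc[OF rk N N] NN Comp_Idt_left[OF rk] by simp
  also have "\<dots> = k"
    using Comp_assoc[OF k r s] sr Comp_Idt_left[OF k] by simp
  finally show thesis using that[of "s \<cdot> (N \<cdot> c)"] Comp_Hom[OF Nc s] by simp
qed

end

section \<open>The category of chosen triangles\<close>

locale chosen_triangles = puppe_triangulated T
  for T :: "('o, 'm, 'z) tricat_scheme" (structure) +
  fixes u v :: "'m \<Rightarrow> 'm"
  assumes chosen: "f \<in> Arr T \<Longrightarrow> (f, u f, v f) \<in> Dist T"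
begin

section \<open>Morphisms of chosen triangles as triples of components\<close>

abbreviation cone :: "'m \<Rightarrow> 'o" where
  "cone f \<equiv> Cod T (u f)"

lemma chosen_Hom:
  assumes "f \<in> Arr T"
  shows "f \<in> Hom T (Dom T f) (Cod T f)"
    and "u f \<in> Hom T (Cod T f) (cone f)"
    and "v f \<in> Hom T (cone f) (FObj (Shift T) (Dom T f))"
  using Dist_diagram[OF chosen[OF assms]] unfolding tri_diagram_def Hom_def by auto

lemma chosen_Obj:
  assumes "f \<in> Arr T"
  shows "Dom T f \<in> Obj T" "Cod T f \<in> Obj T" "cone f \<in> Obj T" "FObj (Shift T) (Dom T f) \<in> Obj T"
  using chosen_Hom[OF assms] Hom_Obj by blast+

text \<open>Restates \<open>tri_morphism\<close> between chosen triangles with the objects written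
  as \<open>Dom T f\<close>, \<open>Cod T f\<close> and \<open>cone f\<close> instead of domains of
  \<open>u f\<close> and \<open>v f\<close>, so that they match the identity and zero arrows of
  \<open>Triangles0\<close>.\<close>

definition triple :: "'m \<Rightarrow> 'm \<Rightarrow> 'm \<Rightarrow> 'm \<Rightarrow> 'm \<Rightarrow> bool" where
  "triple f f' a b c \<longleftrightarrow> f \<in> Arr T \<and> f' \<in> Arr T \<and>
    a \<in> Hom T (Dom T f) (Dom T f') \<and> b \<in> Hom T (Cod T f) (Cod T f') \<and>
    c \<in> Hom T (cone f) (cone f') \<and>
    b \<cdot> f = f' \<cdot> a \<and> c \<cdot> u f = u f' \<cdot> b \<and> FArr (Shift T) a \<cdot> v f = v f' \<cdot> c"

lemma Arr_Triangles0:
  "Arr (Triangles0 T u v) = {((f, f'), (a, b, c)) | f f' a b c. triple f f' a b c}"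
proof -
  have "Dom T (u f) = Cod T f \<and> Dom T (v f) = cone f" if "f \<in> Arr T" for f
    using chosen_Hom[OF that] unfolding Hom_def by auto
  then show ?thesis
    by (auto simp: Triangles0_def triple_def tri_morphism_def)
qed

lemma Triangles0_sel:
  "Obj (Triangles0 T u v) = Arr T"
  "Dom (Triangles0 T u v) ((f, f'), t) = f"
  "Cod (Triangles0 T u v) ((f, f'), t) = f'"
  "Idt (Triangles0 T u v) f = ((f, f), (Idt T (Dom T f), Idt T (Cod T f), Idt T (cone f)))"
  "((g, f''), (a', b', c')) \<cdot>\<^bsub>Triangles0 T u v\<^esub> ((f, f'), (a, b, c)) =
    ((f, f''), (a' \<cdot> a, b' \<cdot> b, c' \<cdot> c))"
  "((f, f'), (a, b, c)) \<boxplus>\<^bsub>Triangles0 T u v\<^esub> ((g, g'), (a', b', c')) =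
    ((f, f'), (a \<boxplus> a', b \<boxplus> b', c \<boxplus> c'))"
  "Zero (Triangles0 T u v) f f' = ((f, f'), (Zero T (Dom T f) (Dom T f'),
    Zero T (Cod T f) (Cod T f'), Zero T (cone f) (cone f')))"
  unfolding Triangles0_def by simp_all

lemma Hom_Triangles0:
  "Hom (Triangles0 T u v) f f' = {((f, f'), (a, b, c)) | a b c. triple f f' a b c}"
  unfolding Hom_def Arr_Triangles0 by (auto simp: Triangles0_sel)

lemma triple_Hom:
  assumes "triple f f' a b c"
  shows "f \<in> Arr T" "f' \<in> Arr T"
    "a \<in> Hom T (Dom T f) (Dom T f')" "b \<in> Hom T (Cod T f) (Cod T f')"
    "c \<in> Hom T (cone f) (cone f')"
    "FArr (Shift T) a \<in> Hom T (FObj (Shift T) (Dom T f)) (FObj (Shift T) (Dom T f'))"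
  using assms Shift.FArr_Hom[of a] unfolding triple_def by blast+

text \<open>A destruction rule for equational goals: it keeps the types of the components and drops
  the commuting squares, so that each law reduces to the same law in \<open>T\<close>.\<close>

lemma triple_components:
  "triple f f' a b c \<Longrightarrow> a \<in> Hom T (Dom T f) (Dom T f') \<and> b \<in> Hom T (Cod T f) (Cod T f') \<and>
    c \<in> Hom T (cone f) (cone f')"
  by (simp add: triple_def)

lemma triple_eq:
  assumes "triple f f' a b c"
  shows "b \<cdot> f = f' \<cdot> a" "c \<cdot> u f = u f' \<cdot> b" "FArr (Shift T) a \<cdot> v f = v f' \<cdot> c"
  using assms unfolding triple_def by auto

text \<open>The three squares of a triple have the same shape, so closure under composition, and
  below under sums and negatives, is settled once for an abstract square and used three
  times.\<close>

lemma comp_square: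
  assumes "x \<in> Hom T A B" "y \<in> Hom T A' B'" "z \<in> Hom T A'' B''"
    and "a \<in> Hom T A A'" "b \<in> Hom T B B'" "a' \<in> Hom T A' A''" "b' \<in> Hom T B' B''"
    and "b \<cdot> x = y \<cdot> a" "b' \<cdot> y = z \<cdot> a'"
  shows "(b' \<cdot> b) \<cdot> x = z \<cdot> (a' \<cdot> a)"
  using Comp_assoc[OF assms(1,5,7)] Comp_assoc[OF assms(4,2,7)] Comp_assoc[OF assms(4,6,3)]
    assms(8,9) by simp

lemma add_square:
  assumes "x \<in> Hom T A B" "y \<in> Hom T A' B'"
    and "a \<in> Hom T A A'" "b \<in> Hom T B B'" "a' \<in> Hom T A A'" "b' \<in> Hom T B B'"
    and "b \<cdot> x = y \<cdot> a" "b' \<cdot> x = y \<cdot> a'"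
  shows "(b \<boxplus> b') \<cdot> x = y \<cdot> (a \<boxplus> a')"
  using Comp_Add_left[OF assms(1,4,6)] Comp_Add_right[OF assms(3,5,2)] assms(7,8) by simp

lemma neg_square:
  assumes "x \<in> Hom T A B" "y \<in> Hom T A' B'"
    and "a \<in> Hom T A A'" "b \<in> Hom T B B'" "b \<cdot> x = y \<cdot> a"
  shows "Neg T b \<cdot> x = y \<cdot> Neg T a"
  using Comp_Neg_left[OF assms(1,4)] Comp_Neg_right[OF assms(3,2)] assms(5) by simp

section \<open>Identities, composites, sums, negatives and zeros of triples\<close>

lemma triple_Idt:
  assumes "f \<in> Arr T"
  shows "triple f f (Idt T (Dom T f)) (Idt T (Cod T f)) (Idt T (cone f))"
proof -
  note o = chosen_Obj[OF assms] and k = chosen_Hom[OF assms]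
  show ?thesis
    unfolding triple_def
    using assms Idt_Hom[OF o(1)] Idt_Hom[OF o(2)] Idt_Hom[OF o(3)] Shift.FArr_Idt[OF o(1)]
      Comp_Idt_left[OF k(1)] Comp_Idt_left[OF k(2)] Comp_Idt_left[OF k(3)]
      Comp_Idt_right[OF k(1)] Comp_Idt_right[OF k(2)] Comp_Idt_right[OF k(3)] by simp
qed

lemma triple_Comp:
  assumes t: "triple f f' a b c" and t': "triple f' f'' a' b' c'"
  shows "triple f f'' (a' \<cdot> a) (b' \<cdot> b) (c' \<cdot> c)"
proof -
  note h = triple_Hom[OF t] and h' = triple_Hom[OF t']
  note k = chosen_Hom[OF h(1)] and k' = chosen_Hom[OF h(2)] and k'' = chosen_Hom[OF h'(2)]
  note e = triple_eq[OF t] and e' = triple_eq[OF t']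
  show ?thesis
    unfolding triple_def
    using h(1) h'(2) Comp_Hom[OF h(3) h'(3)] Comp_Hom[OF h(4) h'(4)] Comp_Hom[OF h(5) h'(5)]
      comp_square[OF k(1) k'(1) k''(1) h(3,4) h'(3,4) e(1) e'(1)]
      comp_square[OF k(2) k'(2) k''(2) h(4,5) h'(4,5) e(2) e'(2)]
      comp_square[OF k(3) k'(3) k''(3) h(5,6) h'(5,6) e(3) e'(3)]
      Shift.FArr_Comp[OF h(3) h'(3)] by simp
qed

text \<open>The third square needs (a + a')[1] = a[1] + a'[1], which is additivity of the shift.
  Negatives and zeros below use it in the same place.\<close>

lemma triple_Add:
  assumes t: "triple f f' a b c" and t': "triple f f' a' b' c'"
  shows "triple f f' (a \<boxplus> a') (b \<boxplus> b') (c \<boxplus> c')"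
proof -
  note h = triple_Hom[OF t] and h' = triple_Hom[OF t']
  note k = chosen_Hom[OF h(1)] and k' = chosen_Hom[OF h(2)]
  note e = triple_eq[OF t] and e' = triple_eq[OF t']
  show ?thesis
    unfolding triple_def
    using h(1,2) Add_Hom[OF h(3) h'(3)] Add_Hom[OF h(4) h'(4)] Add_Hom[OF h(5) h'(5)]
      add_square[OF k(1) k'(1) h(3,4) h'(3,4) e(1) e'(1)]
      add_square[OF k(2) k'(2) h(4,5) h'(4,5) e(2) e'(2)]
      add_square[OF k(3) k'(3) h(5,6) h'(5,6) e(3) e'(3)]
      Shift.FArr_Add[OF h(3) h'(3)] by simp
qed

lemma triple_Neg:
  assumes t: "triple f f' a b c"
  shows "triple f f' (Neg T a) (Neg T b) (Neg T c)"
proof -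
  note h = triple_Hom[OF t]
  note k = chosen_Hom[OF h(1)] and k' = chosen_Hom[OF h(2)]
  note e = triple_eq[OF t]
  show ?thesis
    unfolding triple_def
    using h(1,2) Neg_Hom[OF h(3)] Neg_Hom[OF h(4)] Neg_Hom[OF h(5)]
      neg_square[OF k(1) k'(1) h(3,4) e(1)]
      neg_square[OF k(2) k'(2) h(4,5) e(2)]
      neg_square[OF k(3) k'(3) h(5,6) e(3)]
      Shift.FArr_Neg[OF h(3)] by simp
qed

lemma triple_Zero:
  assumes f: "f \<in> Arr T" and f': "f' \<in> Arr T"
  shows "triple f f' (Zero T (Dom T f) (Dom T f')) (Zero T (Cod T f) (Cod T f'))
    (Zero T (cone f) (cone f'))"
proof -
  note o = chosen_Obj[OF f] and o' = chosen_Obj[OF f']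
  note k = chosen_Hom[OF f] and k' = chosen_Hom[OF f']
  show ?thesis
    unfolding triple_def
    using f f' Zero_Hom[OF o(1) o'(1)] Zero_Hom[OF o(2) o'(2)] Zero_Hom[OF o(3) o'(3)]
      Shift.FArr_Zero[OF o(1) o'(1)]
      Comp_Zero_left[OF k(1) o'(2)] Comp_Zero_left[OF k(2) o'(3)] Comp_Zero_left[OF k(3) o'(4)]
      Comp_Zero_right[OF k'(1) o(1)] Comp_Zero_right[OF k'(2) o(2)] Comp_Zero_right[OF k'(3) o(3)]
    by simp
qed

section \<open>Preadditive structure on the category of chosen triangles\<close>

lemma preadditive_Triangles0: "preadditive_category (Triangles0 T u v)" (is "preadditive_category ?R")
proof -
  note sel = Triangles0_sel
  have "category ?R"
  proof
    fix f assume "f \<in> Arr ?R"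
    then show "Dom ?R f \<in> Obj ?R" "Cod ?R f \<in> Obj ?R"
      unfolding Arr_Triangles0 using triple_Hom by (auto simp: sel)
  next
    fix X assume "X \<in> Obj ?R"
    then show "Idt ?R X \<in> Hom ?R X X"
      using triple_Idt by (simp add: Hom_Triangles0 sel)
  next
    fix f g X Y Z assume "f \<in> Hom ?R X Y" "g \<in> Hom ?R Y Z"
    then show "g \<cdot>\<^bsub>?R\<^esub> f \<in> Hom ?R X Z"
      using triple_Comp by (auto simp: Hom_Triangles0 sel)
  next
    fix f X Y assume "f \<in> Hom ?R X Y"
    then show "Idt ?R Y \<cdot>\<^bsub>?R\<^esub> f = f" "f \<cdot>\<^bsub>?R\<^esub> Idt ?R X = f"
      by (auto simp: Hom_Triangles0 sel intro: Comp_Idt_left Comp_Idt_right dest!: triple_components)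
  next
    fix f g h W X Y Z assume "f \<in> Hom ?R W X" "g \<in> Hom ?R X Y" "h \<in> Hom ?R Y Z"
    then show "(h \<cdot>\<^bsub>?R\<^esub> g) \<cdot>\<^bsub>?R\<^esub> f = h \<cdot>\<^bsub>?R\<^esub> (g \<cdot>\<^bsub>?R\<^esub> f)"
      unfolding Hom_Triangles0 by (auto simp: sel intro: Comp_assoc dest!: triple_components)
  qed
  then show ?thesis
  proof (rule preadditive_category.intro[OF _ preadditive_category_axioms.intro])
    fix X Y assume "X \<in> Obj ?R" "Y \<in> Obj ?R"
    then have X: "X \<in> Arr T" and Y: "Y \<in> Arr T" by (simp_all add: sel)
    show "comm_group (Hom_group ?R X Y)"
    proof (rule comm_groupI)
      fix x assume x: "x \<in> carrier (Hom_group ?R X Y)"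
      then obtain a b c where xe: "x = ((X, Y), (a, b, c))" and t: "triple X Y a b c"
        by (auto simp: Hom_group_def Hom_Triangles0)
      show "\<one>\<^bsub>Hom_group ?R X Y\<^esub> \<otimes>\<^bsub>Hom_group ?R X Y\<^esub> x = x"
        using triple_Hom[OF t] Add_Zero_left by (simp add: Hom_group_def sel xe)
      show "\<exists>y \<in> carrier (Hom_group ?R X Y).
          y \<otimes>\<^bsub>Hom_group ?R X Y\<^esub> x = \<one>\<^bsub>Hom_group ?R X Y\<^esub>"
        using triple_Hom[OF t] triple_Neg[OF t] Add_Neg_left
        by (intro bexI[where x = "((X, Y), (Neg T a, Neg T b, Neg T c))"])
          (simp_all add: Hom_group_def sel xe Hom_Triangles0)
    next
      show "\<one>\<^bsub>Hom_group ?R X Y\<^esub> \<in> carrier (Hom_group ?R X Y)"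
        using triple_Zero[OF X Y] by (simp add: Hom_group_def sel Hom_Triangles0)
    next
      fix x y assume xy: "x \<in> carrier (Hom_group ?R X Y)" "y \<in> carrier (Hom_group ?R X Y)"
      then show "x \<otimes>\<^bsub>Hom_group ?R X Y\<^esub> y \<in> carrier (Hom_group ?R X Y)"
        using triple_Add by (auto simp: Hom_group_def sel Hom_Triangles0)
      show "x \<otimes>\<^bsub>Hom_group ?R X Y\<^esub> y = y \<otimes>\<^bsub>Hom_group ?R X Y\<^esub> x"
        using xy unfolding Hom_group_def Hom_Triangles0
        by (auto simp: sel intro: Add_commute dest!: triple_components)
      fix z assume "z \<in> carrier (Hom_group ?R X Y)"
      with xy show "x \<otimes>\<^bsub>Hom_group ?R X Y\<^esub> y \<otimes>\<^bsub>Hom_group ?R X Y\<^esub> z =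
          x \<otimes>\<^bsub>Hom_group ?R X Y\<^esub> (y \<otimes>\<^bsub>Hom_group ?R X Y\<^esub> z)"
        unfolding Hom_group_def Hom_Triangles0
        by (auto simp: sel intro: Add_assoc dest!: triple_components)
    qed
  next
    fix f g g' X Y Z assume "f \<in> Hom ?R X Y" "g \<in> Hom ?R Y Z" "g' \<in> Hom ?R Y Z"
    then show "(g \<boxplus>\<^bsub>?R\<^esub> g') \<cdot>\<^bsub>?R\<^esub> f = (g \<cdot>\<^bsub>?R\<^esub> f) \<boxplus>\<^bsub>?R\<^esub> (g' \<cdot>\<^bsub>?R\<^esub> f)"
      unfolding Hom_Triangles0 by (auto simp: sel intro: Comp_Add_left dest!: triple_components)
  next
    fix f f' g X Y Z assume "f \<in> Hom ?R X Y" "f' \<in> Hom ?R X Y" "g \<in> Hom ?R Y Z"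
    then show "g \<cdot>\<^bsub>?R\<^esub> (f \<boxplus>\<^bsub>?R\<^esub> f') = (g \<cdot>\<^bsub>?R\<^esub> f) \<boxplus>\<^bsub>?R\<^esub> (g \<cdot>\<^bsub>?R\<^esub> f')"
      unfolding Hom_Triangles0 by (auto simp: sel intro: Comp_Add_right dest!: triple_components)
  qed
qed

section \<open>The kernel of the projection and its square\<close>

lemma kernel_Triangles0_proj:
  "fctr_kernel (Triangles0 T u v) (arrow_cat T) Triangles0_proj =
    {((f, f'), (Zero T (Dom T f) (Dom T f'), Zero T (Cod T f) (Cod T f'), c)) | f f' c.
      triple f f' (Zero T (Dom T f) (Dom T f')) (Zero T (Cod T f) (Cod T f')) c}"
  \<comment> \<open>The zero arrow of \<open>arrow_cat T\<close> prescribes the first two components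
    and leaves the third one free within the triple condition.\<close>
  unfolding fctr_kernel_def Arr_Triangles0
  by (auto simp: Triangles0_sel Triangles0_proj_def arrow_cat_def)

lemma kernel_Comp_eq_Zero:
  assumes t: "triple f f' (Zero T (Dom T f) (Dom T f')) (Zero T (Cod T f) (Cod T f')) c"
    and t': "triple f' f'' (Zero T (Dom T f') (Dom T f'')) (Zero T (Cod T f') (Cod T f'')) c'"
  shows "c' \<cdot> c = Zero T (cone f) (cone f'')"
proof -
  note h = triple_Hom[OF t] and h' = triple_Hom[OF t']
  note o = chosen_Obj[OF h(1)] and o' = chosen_Obj[OF h(2)] and o'' = chosen_Obj[OF h'(2)]
  note k = chosen_Hom[OF h(1)] and k' = chosen_Hom[OF h(2)] and k'' = chosen_Hom[OF h'(2)]
  have c'u: "c' \<cdot> u f' = Zero T (Cod T f') (cone f'')"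
    using triple_eq(2)[OF t'] Comp_Zero_right[OF k''(2) o'(2)] by simp
  \<comment> \<open>The third square with zero first component, using 0[1] = 0.\<close>
  have vc: "v f' \<cdot> c = Zero T (cone f) (FObj (Shift T) (Dom T f'))"
    using triple_eq(3)[OF t] Shift.FArr_Zero[OF o(1) o'(1)] Comp_Zero_left[OF k(3) o'(4)] by simp
  have "Dom T (u f') = Cod T f'" "Cod T (v f') = FObj (Shift T) (Dom T f')"
    using k'(2,3) unfolding Hom_def by auto
  \<comment> \<open>The weak cokernel property is applied to the rotated triangle, whose first two
    maps are \<open>u f'\<close> and \<open>v f'\<close>.\<close>
  then obtain e where e: "e \<in> Hom T (FObj (Shift T) (Dom T f')) (cone f'')" and ce: "c' = e \<cdot> v f'"
    using weak_cokernel[OF TR3[OF chosen[OF h(2)]], of c'] h'(5) c'u by metis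
  show ?thesis
    using Comp_assoc[OF h(5) k'(3) e] vc ce Comp_Zero_right[OF e o(3)] by simp
qed

lemma square_zero_kernel:
  "square_zero_ideal (Triangles0 T u v) (fctr_kernel (Triangles0 T u v) (arrow_cat T) Triangles0_proj)"
  (is "square_zero_ideal ?R ?K")
proof -
  note sel = Triangles0_sel
  interpret R: preadditive_category ?R by (rule preadditive_Triangles0)
  show ?thesis
  proof (intro square_zero_ideal.intro cat_ideal.intro cat_ideal_axioms.intro
      square_zero_ideal_axioms.intro preadditive_Triangles0)
    show "?K \<subseteq> Arr ?R" unfolding fctr_kernel_def by blast
  next
    fix X Y assume "X \<in> Obj ?R" "Y \<in> Obj ?R"
    then have X: "X \<in> Arr T" and Y: "Y \<in> Arr T" and G: "comm_group (Hom_group ?R X Y)"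
      using R.Hom_comm_group by (simp_all add: sel)
    note oX = chosen_Obj[OF X] and oY = chosen_Obj[OF Y]
    interpret G: comm_group "Hom_group ?R X Y" by (rule G)
    let ?z = "Zero T (Dom T X) (Dom T Y)" and ?w = "Zero T (Cod T X) (Cod T Y)"
    \<comment> \<open>Zero components stay zero under sums and negatives, so subgroup closure only
      concerns the third component.\<close>
    have zz: "?z \<boxplus> ?z = ?z" "?w \<boxplus> ?w = ?w"
      using Add_Zero_left Zero_Hom oX oY by blast+
    have nz: "Neg T ?z = ?z" "Neg T ?w = ?w"
      using Neg_unique Zero_Hom zz oX oY by metis+
    have KH: "?K \<inter> Hom ?R X Y = {((X, Y), (?z, ?w, c)) | c. triple X Y ?z ?w c}"
      unfolding kernel_Triangles0_proj Hom_Triangles0 by blast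
    show "subgroup (?K \<inter> Hom ?R X Y) (Hom_group ?R X Y)"
    proof (rule G.subgroupI)
      show "?K \<inter> Hom ?R X Y \<subseteq> carrier (Hom_group ?R X Y)" by (simp add: Hom_group_def)
      show "?K \<inter> Hom ?R X Y \<noteq> {}" unfolding KH using triple_Zero[OF X Y] by blast
    next
      fix x assume "x \<in> ?K \<inter> Hom ?R X Y"
      then obtain c where x: "x = ((X, Y), (?z, ?w, c))" and t: "triple X Y ?z ?w c"
        unfolding KH by blast
      \<comment> \<open>The candidate inverse is the componentwise negative, with the first two
        negated zeros simplified by \<open>nz\<close>.\<close>
      let ?y = "((X, Y), (?z, ?w, Neg T c))"
      have ty: "triple X Y ?z ?w (Neg T c)" using triple_Neg[OF t] nz by simp
      have "inv\<^bsub>Hom_group ?R X Y\<^esub> x = ?y"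
      proof (rule G.inv_equality)
        show "?y \<otimes>\<^bsub>Hom_group ?R X Y\<^esub> x = \<one>\<^bsub>Hom_group ?R X Y\<^esub>"
          using zz Add_Neg_left[OF triple_Hom(5)[OF t]] by (simp add: Hom_group_def sel x)
      qed (use t ty in \<open>simp_all add: Hom_group_def Hom_Triangles0 x\<close>)
      then show "inv\<^bsub>Hom_group ?R X Y\<^esub> x \<in> ?K \<inter> Hom ?R X Y" unfolding KH using ty by blast
    next
      fix x y assume "x \<in> ?K \<inter> Hom ?R X Y" "y \<in> ?K \<inter> Hom ?R X Y"
      then obtain c d where x: "x = ((X, Y), (?z, ?w, c))" "triple X Y ?z ?w c"
        and y: "y = ((X, Y), (?z, ?w, d))" "triple X Y ?z ?w d"
        unfolding KH by blast
      show "x \<otimes>\<^bsub>Hom_group ?R X Y\<^esub> y \<in> ?K \<inter> Hom ?R X Y"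
        unfolding KH using triple_Add[OF x(2) y(2)] zz by (simp add: Hom_group_def sel x(1) y(1))
    qed
  next
    fix f g assume "f \<in> ?K" "g \<in> Arr ?R" "Cod ?R f = Dom ?R g"
    then obtain X Y Z c a' b' c'
      where f: "f = ((X, Y), (Zero T (Dom T X) (Dom T Y), Zero T (Cod T X) (Cod T Y), c))"
        and t: "triple X Y (Zero T (Dom T X) (Dom T Y)) (Zero T (Cod T X) (Cod T Y)) c"
        and g: "g = ((Y, Z), (a', b', c'))" and t': "triple Y Z a' b' c'"
      unfolding kernel_Triangles0_proj Arr_Triangles0 by (auto simp: sel)
    \<comment> \<open>The first two components of the composite have a zero factor on the right; in
      the next case the zero factor is on the left.\<close>
    show "g \<cdot>\<^bsub>?R\<^esub> f \<in> ?K"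
      using triple_Comp[OF t t'] triple_Hom[OF t'] chosen_Obj[OF triple_Hom(1)[OF t]]
      unfolding kernel_Triangles0_proj f g by (simp add: sel Comp_Zero_right)
  next
    fix f g assume "f \<in> Arr ?R" "g \<in> ?K" "Cod ?R f = Dom ?R g"
    then obtain X Y Z a b c c'
      where f: "f = ((X, Y), (a, b, c))" and t: "triple X Y a b c"
        and g: "g = ((Y, Z), (Zero T (Dom T Y) (Dom T Z), Zero T (Cod T Y) (Cod T Z), c'))"
        and t': "triple Y Z (Zero T (Dom T Y) (Dom T Z)) (Zero T (Cod T Y) (Cod T Z)) c'"
      unfolding kernel_Triangles0_proj Arr_Triangles0 by (auto simp: sel)
    show "g \<cdot>\<^bsub>?R\<^esub> f \<in> ?K"
      using triple_Comp[OF t t'] triple_Hom[OF t] chosen_Obj[OF triple_Hom(2)[OF t']]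
      unfolding kernel_Triangles0_proj f g by (simp add: sel Comp_Zero_left)
  next
    fix f g assume "f \<in> ?K" "g \<in> ?K" "Cod ?R f = Dom ?R g"
    then obtain X Y Z c c'
      where f: "f = ((X, Y), (Zero T (Dom T X) (Dom T Y), Zero T (Cod T X) (Cod T Y), c))"
        and t: "triple X Y (Zero T (Dom T X) (Dom T Y)) (Zero T (Cod T X) (Cod T Y)) c"
        and g: "g = ((Y, Z), (Zero T (Dom T Y) (Dom T Z), Zero T (Cod T Y) (Cod T Z), c'))"
        and t': "triple Y Z (Zero T (Dom T Y) (Dom T Z)) (Zero T (Cod T Y) (Cod T Z)) c'"
      unfolding kernel_Triangles0_proj by (auto simp: sel)
    \<comment> \<open>The first two components are composites of zero arrows; the third is
      \<open>kernel_Comp_eq_Zero\<close>.\<close>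
    show "g \<cdot>\<^bsub>?R\<^esub> f = Zero ?R (Dom ?R f) (Cod ?R g)"
      using kernel_Comp_eq_Zero[OF t t'] triple_Hom[OF t'] chosen_Obj[OF triple_Hom(1)[OF t]]
      unfolding f g by (simp add: sel Comp_Zero_right)
  qed
qed

end

theorem lemma3p2p2:
  fixes T :: "('o, 'm, 'z) tricat_scheme"
    and u v :: "'m \<Rightarrow> 'm"
  assumes "puppe_triangulated T"
    and "\<And>f. f \<in> Arr T \<Longrightarrow> (f, u f, v f) \<in> Dist T"
  shows "square_zero_ideal (Triangles0 T u v)
    (fctr_kernel (Triangles0 T u v) (arrow_cat T) Triangles0_proj)"
proof -
  interpret puppe_triangulated T by fact
  interpret chosen_triangles T u v by unfold_locales fact
  show ?thesis by (rule square_zero_kernel)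
qed

end
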